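(* Let $G$ be a connected weighted undirected graph with vertex set $V$ and modularity matrix $M$. Let $\{S_1,\ldots,S_k\}$ be a partition of $V$, with $k\ge 2$, such that $Q(S_i)>0$ for all $i$ and $Q(S_i,S_j)\le 0$ for all $i\neq j$. Consider the $k\times k$ matrix $C$ with $C_{ii}=Q(S_i)$ and $C_{ij}=Q(S_i,S_j)$ for $i\neq j$. If $C$ is irreducible, then $M$ has at least $k-1$ positive eigenvalues (counted with multiplicity).
   Context: A graph $G=(V,E,\omega)$, $V=\{1,\dots,n\}$, is finite, undirected, connected, without multiple edges (loops are allowed), with edge weights $\omega:E\to\mathbb{R}^+$. Its adjacency matrix $A=(a_{ij})$ is the symmetric matrix with $a_{ij}=\omega(ij)>0$ if $ij\in E$ and $a_{ij}=0$ otherwise. The degree is $d_i=\sum_j a_{ij}$, $d=(d_1,\dots,d_n)^T$. For $S\subseteq V$, $\mathrm{vol}\,S=\sum_{i\in S}d_i$, $\mathrm{vol}\,G=\mathrm{vol}\,V$, and $\mathbf 1_S\in\{0,1\}^n$ is the characteristic vector of $S$. For $S,T\subseteq V$, $e(S,T)=\mathbf 1_S^TA\mathbf 1_T$. The modularity matrix is $M=A-\frac{1}{\mathrm{vol}\,G}dd^T$. The modularity of $S\subseteq V$ is $Q(S)=e(S,S)-(\mathrm{vol}\,S)^2/\mathrm{vol}\,G=\mathbf 1_S^TM\mathbf 1_S$. The joint modularity of disjoint $S_1,S_2\subseteq V$ is $Q(S_1,S_2)=e(S_1,S_2)-\frac{\mathrm{vol}\,S_1\,\mathrm{vol}\,S_2}{\mathrm{vol}\,G}=\mathbf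 1_{S_1}^TM\mathbf 1_{S_2}$. A partition of $V$ is a collection of pairwise disjoint subsets with union $V$. A symmetric matrix is irreducible if it cannot be brought to block-diagonal form with at least two blocks by a simultaneous permutation of rows and columns. *)

theory Defs
  imports "Jordan_Normal_Form.Char_Poly" "HOL-Library.Disjoint_Sets"
begin

section \<open>Weighted graphs\<close>

text \<open>
  The vertices are \<open>0, \<dots>, n - 1\<close>, so that they index rows and columns of matrices directly.
  An undirected edge is the set of its end points; the edge set therefore has no multiple
  edges, and a loop at \<open>i\<close> is the singleton \<open>{i}\<close>.
\<close>

record wgraph =
  nverts :: nat
  edges :: "nat set set"
  weight :: "nat set \<Rightarrow> real"

definition verts :: "wgraph \<Rightarrow> nat set" where
  "verts G = {..<nverts G}"

definition weighted_graph :: "wgraph \<Rightarrow> bool" where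
  "weighted_graph G \<longleftrightarrow>
     edges G \<subseteq> {{i, j} | i j. i \<in> verts G \<and> j \<in> verts G} \<and>
     (\<forall>e \<in> edges G. weight G e > 0)"

definition connected_graph :: "wgraph \<Rightarrow> bool" where
  "connected_graph G \<longleftrightarrow>
     (\<forall>i \<in> verts G. \<forall>j \<in> verts G. (i, j) \<in> {(u, v). {u, v} \<in> edges G}\<^sup>*)"

definition adj_mat :: "wgraph \<Rightarrow> real mat" where
  "adj_mat G = mat (nverts G) (nverts G)
     (\<lambda>(i, j). if {i, j} \<in> edges G then weight G {i, j} else 0)"

definition deg_vec :: "wgraph \<Rightarrow> real vec" where
  "deg_vec G = vec (nverts G) (\<lambda>i. \<Sum>j<nverts G. adj_mat G $$ (i, j))"

definition vol :: "wgraph \<Rightarrow> nat set \<Rightarrow> real" where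
  "vol G S = (\<Sum>i\<in>S. deg_vec G $ i)"

definition char_vec :: "wgraph \<Rightarrow> nat set \<Rightarrow> real vec" where
  "char_vec G S = vec (nverts G) (\<lambda>i. if i \<in> S then 1 else 0)"

definition edge_weight :: "wgraph \<Rightarrow> nat set \<Rightarrow> nat set \<Rightarrow> real" where
  "edge_weight G S T = char_vec G S \<bullet> (adj_mat G *\<^sub>v char_vec G T)"


section \<open>Modularity\<close>

definition modularity_mat :: "wgraph \<Rightarrow> real mat" where
  "modularity_mat G = adj_mat G - (1 / vol G (verts G)) \<cdot>\<^sub>m
     mat (nverts G) (nverts G) (\<lambda>(i, j). deg_vec G $ i * deg_vec G $ j)"

definition modularity :: "wgraph \<Rightarrow> nat set \<Rightarrow> real" where
  "modularity G S = edge_weight G S S - (vol G S)\<^sup>2 / vol G (verts G)"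

text \<open>Only meant for disjoint sets.\<close>

definition joint_modularity :: "wgraph \<Rightarrow> nat set \<Rightarrow> nat set \<Rightarrow> real" where
  "joint_modularity G S T = edge_weight G S T - vol G S * vol G T / vol G (verts G)"

definition community_mat :: "wgraph \<Rightarrow> nat \<Rightarrow> (nat \<Rightarrow> nat set) \<Rightarrow> real mat" where
  "community_mat G k S = mat k k
     (\<lambda>(i, j). if i = j then modularity G (S i) else joint_modularity G (S i) (S j))"


section \<open>Matrices\<close>

text \<open>
  The blocks are required to be non-empty: with \<open>0 \<times> 0\<close> blocks admitted, every
  square matrix would be block-diagonal with two blocks.
\<close>

definition irreducible_mat :: "'a :: zero mat \<Rightarrow> bool" where
  "irreducible_mat A \<longleftrightarrow>
     \<not> (\<exists>p Bs. p permutes {..<dim_row A} \<and> length Bs \<ge> 2 \<and>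
          (\<forall>B \<in> set Bs. square_mat B \<and> dim_row B > 0) \<and>
          mat (dim_row A) (dim_col A) (\<lambda>(i, j). A $$ (p i, p j)) = diag_block_mat Bs)"

text \<open>
  Eigenvalues are counted with algebraic multiplicity, which for the real symmetric matrices
  considered here agrees with the geometric one.
\<close>

definition num_pos_eigenvalues :: "real mat \<Rightarrow> nat" where
  "num_pos_eigenvalues A =
     (\<Sum>x | eigenvalue A x \<and> x > 0. Polynomial.order x (char_poly A))"

end

theory Submission
  imports Defs "Jordan_Normal_Form.Spectral_Radius" "Jordan_Normal_Form.Schur_Decomposition"
begin

text \<open>
  Let \<open>M\<close> be the modularity matrix and \<open>C\<close> the community matrix. Its entries are the values of the
  bilinear form of \<open>M\<close> at the indicator vectors of the communities, so the form of \<open>M\<close> at a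
  combination \<open>\<Sum>i. x i \<cdot> 1(S i)\<close> of indicator vectors is the form of \<open>C\<close> at \<open>x\<close>
  (lemmas \<open>joint_modularity_eq_sum\<close> and \<open>quadratic_form_of_sum\<close>).

  The rows of \<open>M\<close> sum to zero, and the communities partition the vertices, so the rows
  of \<open>C\<close> sum to zero too. As the off-diagonal entries of \<open>C\<close> are non-positive, \<open>C\<close> is the Laplacian
  of a weighted graph whose vertices are the communities:
  \<open>x\<^sup>T C x = (\<Sum>i j. - C i j (x i - x j)\<^sup>2) / 2 \<ge> 0\<close>. Irreducibility of \<open>C\<close> says that this graph
  is connected, so the form vanishes only at constant \<open>x\<close>
  (lemma \<open>irreducible_zero_row_sum_form_pos\<close>).

  Fixing \<open>x 0 = 0\<close> excludes all constant vectors but zero. Hence \<open>M\<close> is positive definite on the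
  \<open>(k - 1)\<close>-dimensional span of the indicator vectors of the other communities. By the spectral
  theorem (\<open>spectral_theorem_real\<close>) a symmetric matrix that is positive definite on an
  \<open>m\<close>-dimensional space has at least \<open>m\<close> positive eigenvalues
  (lemma \<open>num_pos_eigenvalues_ge_positive_subspace\<close>).
\<close>

section \<open>Real symmetric matrices\<close>

lemma index_mult_mat_vec_sum:
  assumes "A \<in> carrier_mat nr nc" "v \<in> carrier_vec nc" "i < nr"
  shows "(A *\<^sub>v v) $ i = (\<Sum>j<nc. A $$ (i,j) * v $ j)"
  using assms by (auto simp: scalar_prod_def lessThan_atLeast0 intro!: sum.cong)

lemma symmetric_mat_adjoint:
  fixes A :: "real mat"
  assumes "A \<in> carrier_mat n n" "A\<^sup>T = A" "x \<in> carrier_vec n" "y \<in> carrier_vec n"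
  shows "(A *\<^sub>v x) \<bullet> y = x \<bullet> (A *\<^sub>v y)"
  using transpose_vec_mult_scalar[OF assms(1) assms(4) assms(3)] assms(2) by simp

lemma scalar_prod_self_pos_iff:
  fixes x :: "real vec"
  assumes "x \<in> carrier_vec n"
  shows "x \<bullet> x > 0 \<longleftrightarrow> x \<noteq> 0\<^sub>v n"
  using conjugate_square_greater_0_vec[OF assms] by simp

text \<open>
  Over \<open>\<complex>\<close> there is an eigenvalue \<open>\<mu>\<close> with an eigenvector \<open>z = x + \<i>y\<close>. Computing
  \<open>x \<bullet> Ay = Ax \<bullet> y\<close> from the real and imaginary parts of \<open>Az = \<mu>z\<close> gives
  \<open>Im \<mu> (|x|\<^sup>2 + |y|\<^sup>2) = 0\<close>. So \<open>\<mu>\<close> is real, and whichever of \<open>x\<close>, \<open>y\<close> is non-zero is a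
  real eigenvector.
\<close>

lemma symmetric_mat_has_eigenvector:
  fixes A :: "real mat"
  assumes A: "A \<in> carrier_mat n n" and sym: "A\<^sup>T = A" and n: "n > 0"
  obtains v e where "v \<in> carrier_vec n" "v \<noteq> 0\<^sub>v n" "A *\<^sub>v v = e \<cdot>\<^sub>v v"
proof -
  let ?A = "map_mat complex_of_real A"
  have A': "?A \<in> carrier_mat n n" using A by simp
  from spectrum_non_empty[OF A' n] obtain \<mu> z where "eigenvector ?A z \<mu>"
    unfolding spectrum_def eigenvalue_def by auto
  hence z: "z \<in> carrier_vec n" "z \<noteq> 0\<^sub>v n" "?A *\<^sub>v z = \<mu> \<cdot>\<^sub>v z"
    using A unfolding eigenvector_def by auto
  define x where "x = map_vec Re z"
  define y where "y = map_vec Im z"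
  have x: "x \<in> carrier_vec n" and y: "y \<in> carrier_vec n" using z(1) by (auto simp: x_def y_def)
  have row: "(\<Sum>j<n. A $$ (i,j) * z $ j) = \<mu> * z $ i" if "i < n" for i
  proof -
    have "(?A *\<^sub>v z) $ i = (\<Sum>j<n. A $$ (i,j) * z $ j)"
      unfolding index_mult_mat_vec_sum[OF A' z(1) that] using that A by simp
    thus ?thesis using z that by simp
  qed
  have Ax: "A *\<^sub>v x = Re \<mu> \<cdot>\<^sub>v x - Im \<mu> \<cdot>\<^sub>v y"
  proof (rule eq_vecI)
    fix i assume "i < dim_vec (Re \<mu> \<cdot>\<^sub>v x - Im \<mu> \<cdot>\<^sub>v y)"
    hence i: "i < n" using y by simp
    have "(A *\<^sub>v x) $ i = (\<Sum>j<n. A $$ (i,j) * Re (z $ j))"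
      unfolding index_mult_mat_vec_sum[OF A x i] using z(1) by (simp add: x_def)
    thus "(A *\<^sub>v x) $ i = (Re \<mu> \<cdot>\<^sub>v x - Im \<mu> \<cdot>\<^sub>v y) $ i"
      using arg_cong[OF row[OF i], of Re] i z(1) by (simp add: x_def y_def)
  qed (use A y in auto)
  have Ay: "A *\<^sub>v y = Im \<mu> \<cdot>\<^sub>v x + Re \<mu> \<cdot>\<^sub>v y"
  proof (rule eq_vecI)
    fix i assume "i < dim_vec (Im \<mu> \<cdot>\<^sub>v x + Re \<mu> \<cdot>\<^sub>v y)"
    hence i: "i < n" using y by simp
    have "(A *\<^sub>v y) $ i = (\<Sum>j<n. A $$ (i,j) * Im (z $ j))"
      unfolding index_mult_mat_vec_sum[OF A y i] using z(1) by (simp add: y_def)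
    thus "(A *\<^sub>v y) $ i = (Im \<mu> \<cdot>\<^sub>v x + Re \<mu> \<cdot>\<^sub>v y) $ i"
      using arg_cong[OF row[OF i], of Im] i z(1) by (simp add: x_def y_def algebra_simps)
  qed (use A y in auto)
  have nz: "x \<noteq> 0\<^sub>v n \<or> y \<noteq> 0\<^sub>v n"
  proof (rule ccontr)
    assume "\<not> ?thesis"
    hence "x $ i = 0 \<and> y $ i = 0" if "i < n" for i using that by simp
    hence "z $ i = 0" if "i < n" for i using that z(1) by (auto simp: x_def y_def complex_eq_iff)
    thus False using z(1,2) by (auto simp: vec_eq_iff)
  qed
  have "Im \<mu> * (x \<bullet> x + y \<bullet> y) = 0"
  proof -
    have "x \<bullet> (A *\<^sub>v y) = Im \<mu> * (x \<bullet> x) + Re \<mu> * (x \<bullet> y)"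
      unfolding Ay using x y by (simp add: scalar_prod_add_distrib[of _ n])
    moreover have "(A *\<^sub>v x) \<bullet> y = Re \<mu> * (x \<bullet> y) - Im \<mu> * (y \<bullet> y)"
      unfolding Ax using x y by (simp add: minus_scalar_prod_distrib[of _ n])
    ultimately show ?thesis using symmetric_mat_adjoint[OF A sym x y] by (simp add: algebra_simps)
  qed
  moreover have "x \<bullet> x + y \<bullet> y > 0"
    using nz scalar_prod_self_pos_iff[OF x] scalar_prod_self_pos_iff[OF y] x y
    by (metis add_nonneg_pos add_pos_nonneg less_eq_real_def scalar_prod_left_zero)
  ultimately have "Im \<mu> = 0" by auto
  hence "A *\<^sub>v x = Re \<mu> \<cdot>\<^sub>v x" "A *\<^sub>v y = Re \<mu> \<cdot>\<^sub>v y"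
    using Ax Ay x y by (auto simp: vec_eq_iff)
  thus ?thesis using nz that x y by blast
qed

text \<open>
  Complete \<open>v\<close> to a basis, apply the Gram-Schmidt process, which leaves the first vector
  untouched, and normalise the resulting columns.
\<close>

lemma orthogonal_mat_with_first_column:
  fixes v :: "real vec"
  assumes v: "v \<in> carrier_vec n" and v0: "v \<noteq> 0\<^sub>v n"
  obtains W c where "W \<in> carrier_mat n n" "W\<^sup>T * W = 1\<^sub>m n" "col W 0 = c \<cdot>\<^sub>v v"
proof -
  interpret cof_vec_space n "TYPE(real)" .
  have n: "n > 0" using v v0 by (cases n) auto
  define b where "b = basis_completion v"
  define ws where "ws = gram_schmidt n b"
  note bc = basis_completion[OF v v0, folded b_def]
  from bc(6,7) n obtain vs where bv: "b = v # vs" by (cases b) auto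
  from gram_schmidt_result[OF bc(2) bc(4) bc(5) refl, folded ws_def] bc(6)
  have ws: "set ws \<subseteq> carrier_vec n" "corthogonal ws" "length ws = n" by auto
  have hdws: "ws ! 0 = v"
    using gram_schmidt_hd[OF v, of vs, folded bv] ws(3) n unfolding ws_def
    by (metis hd_conv_nth list.size(3) less_numeral_extra(3))
  have wsc: "ws ! i \<in> carrier_vec n" if "i < n" for i using ws(1,3) that by auto
  define c where "c i = 1 / sqrt (ws ! i \<bullet> ws ! i)" for i
  define W where "W = mat n n (\<lambda>(j,i). c i * (ws ! i) $ j)"
  have colW: "col W i = c i \<cdot>\<^sub>v (ws ! i)" if "i < n" for i
    using that wsc[OF that] by (auto simp: W_def)
  have W: "W \<in> carrier_mat n n" by (simp add: W_def)
  have "W\<^sup>T * W = 1\<^sub>m n"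
  proof (rule eq_matI)
    fix i j assume "i < dim_row (1\<^sub>m n)" "j < dim_col (1\<^sub>m n)"
    hence ij: "i < n" "j < n" by auto
    have "(W\<^sup>T * W) $$ (i,j) = c i * c j * (ws ! i \<bullet> ws ! j)"
      using ij W wsc[of i] wsc[of j] by (simp add: colW)
    moreover have "ws ! i \<bullet> ws ! j = 0 \<longleftrightarrow> i \<noteq> j"
      using corthogonalD[OF ws(2), of i j] ij ws(3) by simp
    moreover have "c i * c i * (ws ! i \<bullet> ws ! i) = 1"
    proof -
      have "ws ! i \<bullet> ws ! i \<ge> 0" using conjugate_square_ge_0_vec[of "ws ! i"] by simp
      moreover have "ws ! i \<bullet> ws ! i \<noteq> 0" using corthogonalD[OF ws(2), of i i] ij ws(3) by simp
      ultimately show ?thesis by (simp add: c_def)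
    qed
    ultimately show "(W\<^sup>T * W) $$ (i,j) = 1\<^sub>m n $$ (i,j)" using ij by (cases "i = j") auto
  qed (auto simp: W_def)
  thus ?thesis using that[OF W _ , of "c 0"] colW[OF n] hdws by simp
qed

text \<open>
  The induction step of the spectral theorem: a diagonalisation of \<open>W\<^sup>T A W\<close> by an orthogonal
  \<open>Z\<close> yields a diagonalisation of \<open>A\<close> by \<open>W Z\<close>.
\<close>

lemma orthogonal_conj_twice:
  fixes A :: "real mat"
  assumes A: "A \<in> carrier_mat n n" and W: "W \<in> carrier_mat n n" and Z: "Z \<in> carrier_mat n n"
    and D: "D \<in> carrier_mat n n" 
    and WW: "W\<^sup>T * W = 1\<^sub>m n" and ZZ: "Z\<^sup>T * Z = 1\<^sub>m n"
    and WAW: "W\<^sup>T * A * W = Z * D * Z\<^sup>T"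
  shows "(W * Z)\<^sup>T * (W * Z) = 1\<^sub>m n" "A = (W * Z) * D * (W * Z)\<^sup>T"
proof -
  have Wt: "W\<^sup>T \<in> carrier_mat n n" and Zt: "Z\<^sup>T \<in> carrier_mat n n" using W Z by auto
  have WZt: "(W * Z)\<^sup>T = Z\<^sup>T * W\<^sup>T" by (rule transpose_mult[OF W Z])
  have WW': "W * W\<^sup>T = 1\<^sub>m n" by (rule mat_mult_left_right_inverse[OF Wt W WW])
  have "(W * Z)\<^sup>T * (W * Z) = Z\<^sup>T * (W\<^sup>T * W) * Z"
    unfolding WZt using W Z Wt Zt by (simp add: assoc_mult_mat[of _ n n _ n _ n])
  thus "(W * Z)\<^sup>T * (W * Z) = 1\<^sub>m n" using WW ZZ Z Zt by simp
  have "A = (W * W\<^sup>T) * A * (W * W\<^sup>T)" using WW' A by simp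
  also have "\<dots> = W * (W\<^sup>T * A * W) * W\<^sup>T"
    using A W Wt by (simp add: assoc_mult_mat[of _ n n _ n _ n])
  also have "\<dots> = (W * Z) * D * (W * Z)\<^sup>T"
    unfolding WAW WZt using W Wt Z Zt D by (simp add: assoc_mult_mat[of _ n n _ n _ n])
  finally show "A = (W * Z) * D * (W * Z)\<^sup>T" .
qed

text \<open>
  Induction on the dimension. In an orthonormal basis that starts with an eigenvector, the first
  column of the matrix is a multiple of the first unit vector; by symmetry so is the first row,
  and the remaining block is again symmetric.
\<close>

theorem spectral_theorem_real:
  fixes A :: "real mat"
  assumes "A \<in> carrier_mat n n" "A\<^sup>T = A"
  shows "\<exists>P D. P \<in> carrier_mat n n \<and> D \<in> carrier_mat n n \<and> P\<^sup>T * P = 1\<^sub>m n \<and>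
    diagonal_mat D \<and> A = P * D * P\<^sup>T"
  using assms
proof (induction n arbitrary: A)
  case 0
  thus ?case by (intro exI[of _ "1\<^sub>m 0"] exI[of _ A]) (auto simp: diagonal_mat_def)
next
  case (Suc n A)
  note A = Suc.prems(1) and sym = Suc.prems(2)
  from symmetric_mat_has_eigenvector[OF A sym] obtain v e
    where v: "v \<in> carrier_vec (Suc n)" "v \<noteq> 0\<^sub>v (Suc n)" "A *\<^sub>v v = e \<cdot>\<^sub>v v" by auto
  from orthogonal_mat_with_first_column[OF v(1,2)] obtain W c
    where W: "W \<in> carrier_mat (Suc n) (Suc n)" and WW: "W\<^sup>T * W = 1\<^sub>m (Suc n)"
      and col0: "col W 0 = c \<cdot>\<^sub>v v" by metis
  define B where "B = W\<^sup>T * A * W"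
  have Wt: "W\<^sup>T \<in> carrier_mat (Suc n) (Suc n)" using W by simp
  have B: "B \<in> carrier_mat (Suc n) (Suc n)" using W A by (simp add: B_def)
  have Bsym: "B\<^sup>T = B"
    unfolding B_def using W Wt A sym
    by (simp add: transpose_mult[of _ "Suc n" "Suc n" _ "Suc n"] assoc_mult_mat[of _ "Suc n" "Suc n" _ "Suc n" _ "Suc n"])
  have B0: "B $$ (i,0) = (if i = 0 then e else 0)" if i: "i < Suc n" for i
  proof -
    have "A *\<^sub>v col W 0 = e \<cdot>\<^sub>v col W 0"
      using v A col0 by (simp add: mult_mat_vec smult_smult_assoc mult.commute)
    have "B = W\<^sup>T * (A * W)" unfolding B_def by (rule assoc_mult_mat[OF Wt A W])
    hence "B $$ (i,0) = col W i \<bullet> (A *\<^sub>v col W 0)" using i A W by (simp add: mult_mat_vec_def)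
    also have "\<dots> = e * (col W i \<bullet> col W 0)"
      unfolding \<open>A *\<^sub>v col W 0 = _\<close> using W by simp
    also have "col W i \<bullet> col W 0 = (W\<^sup>T * W) $$ (i,0)" using i W by simp
    finally show ?thesis using i unfolding WW by simp
  qed
  have B0': "B $$ (0,j) = (if j = 0 then e else 0)" if "j < Suc n" for j
    using B0[OF that] arg_cong[OF Bsym, of "\<lambda>X. X $$ (j,0)"] B that by simp
  define B' where "B' = mat n n (\<lambda>(i,j). B $$ (Suc i, Suc j))"
  let ?e = "mat 1 1 (\<lambda>_. e)"
  have Bblock: "B = four_block_mat ?e (0\<^sub>m 1 n) (0\<^sub>m n 1) B'"
    using B B0 B0' by (intro eq_matI) (auto simp: B'_def)
  have "B' \<in> carrier_mat n n" by (simp add: B'_def)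
  moreover have "B'\<^sup>T = B'"
  proof (rule eq_matI)
    fix i j assume "i < dim_row B'" "j < dim_col B'"
    thus "B'\<^sup>T $$ (i,j) = B' $$ (i,j)"
      using arg_cong[OF Bsym, of "\<lambda>X. X $$ (Suc i, Suc j)"] B by (simp add: B'_def)
  qed (auto simp: B'_def)
  ultimately obtain P D where P: "P \<in> carrier_mat n n" and D: "D \<in> carrier_mat n n"
    and PP: "P\<^sup>T * P = 1\<^sub>m n" and diagD: "diagonal_mat D" and B': "B' = P * D * P\<^sup>T"
    using Suc.IH[of B'] by auto
  let ?Z = "four_block_mat (1\<^sub>m 1) (0\<^sub>m 1 n) (0\<^sub>m n 1) P"
  let ?D = "four_block_mat ?e (0\<^sub>m 1 n) (0\<^sub>m n 1) D"
  have Zt: "?Z\<^sup>T = four_block_mat (1\<^sub>m 1) (0\<^sub>m 1 n) (0\<^sub>m n 1) P\<^sup>T"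
    using P by (subst transpose_four_block_mat[of _ 1 1 _ n _ n]) auto
  have ZZ: "?Z\<^sup>T * ?Z = 1\<^sub>m (Suc n)"
    unfolding Zt using P PP
    by (subst mult_four_block_mat[of _ 1 1 _ n _ n _ _ 1 _ n]) auto
  have ZDZ: "B = ?Z * ?D * ?Z\<^sup>T"
  proof -
    have e1: "1\<^sub>m 1 * ?e = ?e" "?e * 1\<^sub>m 1 = ?e" by (auto intro!: left_mult_one_mat right_mult_one_mat)
    have "?Z * ?D = four_block_mat ?e (0\<^sub>m 1 n) (0\<^sub>m n 1) (P * D)"
      using P D by (subst mult_four_block_mat[of _ 1 1 _ n _ n _ _ 1 _ n]) (auto simp: e1)
    thus ?thesis unfolding Zt Bblock B'
      using P D by (simp, subst mult_four_block_mat[of _ 1 1 _ n _ n _ _ 1 _ n]) (auto simp: e1)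
  qed
  have Z: "?Z \<in> carrier_mat (Suc n) (Suc n)" and Dc: "?D \<in> carrier_mat (Suc n) (Suc n)"
    using P D by auto
  have "diagonal_mat ?D"
    using diagD D unfolding diagonal_mat_def by (auto simp: less_Suc_eq_0_disj) blast
  with orthogonal_conj_twice[OF A W Z Dc WW ZZ, folded B_def, OF ZDZ] mult_carrier_mat[OF W Z] Dc
  show ?case by blast
qed

section \<open>Counting positive eigenvalues\<close>

lemma order_prod_linear:
  fixes d :: "nat \<Rightarrow> 'a :: idom"
  shows "Polynomial.order x (\<Prod>i<n. [:- d i, 1:]) = card {i. i < n \<and> d i = x}"
proof (induction n)
  case (Suc n)
  have set_eq: "{i. i < Suc n \<and> d i = x} = {i. i < n \<and> d i = x} \<union> (if d n = x then {n} else {})"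
    by (auto simp: less_Suc_eq)
  have order_factor: "Polynomial.order x [:- d n, 1:] = (if d n = x then 1 else 0)"
    using order_power_n_n[of x 1] by (auto simp: order_0I)
  have nz: "(\<Prod>i<n. [:- d i, 1:]) * [:- d n, 1:] \<noteq> 0"
    unfolding mult_eq_0_iff by simp
  show ?case
    unfolding prod.lessThan_Suc order_mult[OF nz] Suc.IH order_factor set_eq
    by (subst card_Un_disjoint) auto
qed simp

lemma num_pos_eigenvalues_diagonalised:
  fixes A :: "real mat"
  assumes P: "P \<in> carrier_mat n n" and D: "D \<in> carrier_mat n n" and PP: "P\<^sup>T * P = 1\<^sub>m n"
    and diag: "diagonal_mat D" and A: "A = P * D * P\<^sup>T"
  shows "num_pos_eigenvalues A = card {i. i < n \<and> D $$ (i,i) > 0}"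
proof -
  have Pt: "P\<^sup>T \<in> carrier_mat n n" using P by simp
  have Ac: "A \<in> carrier_mat n n" using P D A by simp
  have "similar_mat A D"
    using P Pt D Ac PP mat_mult_left_right_inverse[OF Pt P PP] A
    by (intro similar_matI[of _ _ P "P\<^sup>T" n]) auto
  hence "char_poly A = char_poly D" by (rule char_poly_similar)
  also have "\<dots> = (\<Prod>a\<leftarrow>diag_mat D. [:- a, 1:])"
    using D diag by (intro char_poly_upper_triangular[OF D]) (auto simp: diagonal_mat_def upper_triangular_def)
  also have "\<dots> = (\<Prod>i<n. [:- (D $$ (i,i)), 1:])"
    using D by (simp add: diag_mat_def o_def prod.distinct_set_conv_list[symmetric] lessThan_atLeast0)
  finally have cp: "char_poly A = (\<Prod>i<n. [:- (D $$ (i,i)), 1:])" .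
  let ?I = "{i. i < n \<and> D $$ (i,i) > 0}"
  have pos: "{x. eigenvalue A x \<and> x > 0} = (\<lambda>i. D $$ (i,i)) ` ?I"
    unfolding eigenvalue_root_char_poly[OF Ac] cp by (auto simp: poly_prod)
  have "num_pos_eigenvalues A = (\<Sum>x\<in>(\<lambda>i. D $$ (i,i)) ` ?I. card {i \<in> ?I. D $$ (i,i) = x})"
    unfolding num_pos_eigenvalues_def pos cp order_prod_linear
    by (intro sum.cong refl arg_cong[of _ _ card]) auto
  also have "\<dots> = card ?I"
    using sum.image_gen[of ?I "\<lambda>_. 1::nat" "\<lambda>i. D $$ (i,i)"] by simp
  finally show ?thesis .
qed

text \<open>
  Pad the \<open>card I\<close> equations with zero rows to a square system; its determinant vanishes.
\<close>

lemma underdetermined_system_nontrivial: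
  fixes f :: "nat \<Rightarrow> nat \<Rightarrow> 'a :: field"
  assumes "finite I" "card I < m"
  obtains y where "y \<in> carrier_vec m" "y \<noteq> 0\<^sub>v m" "\<And>i. i \<in> I \<Longrightarrow> (\<Sum>j<m. f i j * y $ j) = 0"
proof -
  obtain g where g: "bij_betw g {..<card I} I"
    using ex_bij_betw_nat_finite[OF assms(1)] by (auto simp: lessThan_atLeast0)
  define K where "K = mat m m (\<lambda>(r,j). if r < card I then f (g r) j else 0)"
  have K: "K \<in> carrier_mat m m" by (simp add: K_def)
  \<comment> \<open>Row \<open>card I\<close> of \<open>K\<close> is zero, so Laplace expansion along it gives 0.\<close>
  have "det K = 0"
    unfolding laplace_expansion_row[OF K assms(2)] by (simp add: K_def assms(2))
  then obtain y where y: "y \<in> carrier_vec m" "y \<noteq> 0\<^sub>v m" "K *\<^sub>v y = 0\<^sub>v m"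
    using det_0_iff_vec_prod_zero_field[OF K] by auto
  have "(\<Sum>j<m. f i j * y $ j) = 0" if "i \<in> I" for i
  proof -
    have "i \<in> g ` {..<card I}" using that bij_betw_imp_surj_on[OF g] by simp
    then obtain r where r: "r < card I" "g r = i" by auto
    have "(K *\<^sub>v y) $ r = (\<Sum>j<m. f i j * y $ j)"
      using r assms(2) index_mult_mat_vec_sum[OF K y(1), of r] by (simp add: K_def)
    thus ?thesis using y(3) r assms(2) by simp
  qed
  thus ?thesis using that y by blast
qed

text \<open>
  This is the part of the Courant-Fischer principle that bounds positive eigenvalues from below:
  \<open>X\<close> parametrises an \<open>m\<close>-dimensional space on which the quadratic form of \<open>A\<close> is positive
  definite. If \<open>A\<close> had fewer than \<open>m\<close> positive eigenvalues, then some non-zero \<open>y\<close> would make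
  \<open>X y\<close> orthogonal to all eigenvectors belonging to them, and in eigenvector coordinates
  the form at \<open>X y\<close> would be a sum of non-positive terms.
\<close>

lemma num_pos_eigenvalues_ge_positive_subspace:
  fixes A X :: "real mat"
  assumes A: "A \<in> carrier_mat n n" and sym: "A\<^sup>T = A" and X: "X \<in> carrier_mat n m"
    and pos: "\<And>y. y \<in> carrier_vec m \<Longrightarrow> y \<noteq> 0\<^sub>v m \<Longrightarrow> (X *\<^sub>v y) \<bullet> (A *\<^sub>v (X *\<^sub>v y)) > 0"
  shows "num_pos_eigenvalues A \<ge> m"
proof (rule ccontr)
  from spectral_theorem_real[OF A sym] obtain P D where
    P: "P \<in> carrier_mat n n" and D: "D \<in> carrier_mat n n" and PP: "P\<^sup>T * P = 1\<^sub>m n"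
    and diag: "diagonal_mat D" and Aeq: "A = P * D * P\<^sup>T" by auto
  have Pt: "P\<^sup>T \<in> carrier_mat n n" using P by simp
  let ?I = "{i. i < n \<and> D $$ (i,i) > 0}"
  assume "\<not> num_pos_eigenvalues A \<ge> m"
  hence "card ?I < m" using num_pos_eigenvalues_diagonalised[OF P D PP diag Aeq] by simp
  then obtain y where y: "y \<in> carrier_vec m" "y \<noteq> 0\<^sub>v m"
    and y0: "\<And>i. i \<in> ?I \<Longrightarrow> (\<Sum>j<m. (P\<^sup>T * X) $$ (i,j) * y $ j) = 0"
    using underdetermined_system_nontrivial[of ?I m "\<lambda>i j. (P\<^sup>T * X) $$ (i,j)"] by auto
  define w where "w = X *\<^sub>v y"
  define z where "z = P\<^sup>T *\<^sub>v w"
  have w: "w \<in> carrier_vec n" using X y by (simp add: w_def)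
  have z: "z \<in> carrier_vec n" using Pt w unfolding z_def by (rule mult_mat_vec_carrier)
  have z_I: "z $ i = 0" if "i \<in> ?I" for i
  proof -
    have "z = (P\<^sup>T * X) *\<^sub>v y" unfolding z_def w_def using assoc_mult_mat_vec[OF Pt X y(1)] by simp
    moreover have "i < n" using that by simp
    ultimately have "z $ i = (\<Sum>j<m. (P\<^sup>T * X) $$ (i,j) * y $ j)"
      using index_mult_mat_vec_sum[OF mult_carrier_mat[OF Pt X] y(1)] by simp
    thus ?thesis using y0[OF that] by simp
  qed
  have Dz: "(D *\<^sub>v z) $ i = D $$ (i,i) * z $ i" if "i < n" for i
  proof -
    have "(D *\<^sub>v z) $ i = (\<Sum>j<n. D $$ (i,j) * z $ j)"
      by (rule index_mult_mat_vec_sum[OF D z that])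
    also have "\<dots> = (\<Sum>j<n. if j = i then D $$ (i,i) * z $ i else 0)"
      using diag D that by (intro sum.cong) (auto simp: diagonal_mat_def)
    finally show ?thesis using that by simp
  qed
  have "w \<bullet> (A *\<^sub>v w) = w \<bullet> (P *\<^sub>v (D *\<^sub>v z))"
    unfolding Aeq z_def using P D Pt w
    by (simp add: assoc_mult_mat_vec[of _ n n _ n])
  also have "\<dots> = z \<bullet> (D *\<^sub>v z)"
    unfolding z_def by (rule transpose_vec_mult_scalar[OF P _ w, symmetric])
      (use D z in \<open>auto simp: z_def\<close>)
  also have "\<dots> = (\<Sum>i<n. D $$ (i,i) * (z $ i)\<^sup>2)"
    using Dz D by (auto simp: scalar_prod_def lessThan_atLeast0 power2_eq_square intro!: sum.cong)
  also have "\<dots> \<le> 0"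
  proof (rule sum_nonpos)
    fix i assume "i \<in> {..<n}"
    thus "D $$ (i,i) * (z $ i)\<^sup>2 \<le> 0"
      using z_I[of i] by (cases "D $$ (i,i) > 0") (auto intro: mult_nonpos_nonneg)
  qed
  finally show False using pos[OF y] unfolding w_def by simp
qed

section \<open>Irreducible matrices with zero row sums\<close>

text \<open>
  Listing the indices in \<open>T\<close> first is a permutation that exhibits two diagonal blocks.
\<close>

lemma block_zero_pattern_reducible:
  fixes A :: "'a :: zero mat"
  assumes A: "A \<in> carrier_mat k k" and T: "T \<subset> {..<k}" "T \<noteq> {}"
    and zero: "\<And>i j. i \<in> T \<Longrightarrow> j < k \<Longrightarrow> j \<notin> T \<Longrightarrow> A $$ (i,j) = 0 \<and> A $$ (j,i) = 0"
  shows "\<not> irreducible_mat A"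
proof -
  let ?t = "card T"
  have finT: "finite T" using T finite_subset by blast
  have t0: "?t > 0" using T(2) finT by (simp add: card_gt_0_iff)
  have tk: "?t < k" using psubset_card_mono[OF _ T(1)] by simp
  obtain g where g: "bij_betw g {..<?t} T"
    using ex_bij_betw_nat_finite[OF finT] by (auto simp: lessThan_atLeast0)
  have "card {?t..<k} = card ({..<k} - T)" using T finT by (simp add: card_Diff_subset)
  then obtain h where h: "bij_betw h {?t..<k} ({..<k} - T)"
    using finite_same_card_bij[of "{?t..<k}" "{..<k} - T"] by auto
  define p where "p i = (if i < ?t then g i else if i < k then h i else i)" for i
  have "bij_betw p {..<?t} T" using g by (rule bij_betw_cong[THEN iffD1, rotated]) (simp add: p_def)
  moreover have "bij_betw p {?t..<k} ({..<k} - T)"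
    using h by (rule bij_betw_cong[THEN iffD1, rotated]) (simp add: p_def)
  ultimately have "bij_betw p ({..<?t} \<union> {?t..<k}) (T \<union> ({..<k} - T))"
    by (rule bij_betw_combine) auto
  moreover have "{..<?t} \<union> {?t..<k} = {..<k}" "T \<union> ({..<k} - T) = {..<k}" using tk T by auto
  ultimately have "bij_betw p {..<k} {..<k}" by simp
  hence perm: "p permutes {..<k}" using tk by (intro bij_imp_permutes) (auto simp: p_def)
  have pT: "p i \<in> T" if "i < ?t" for i using that g by (auto simp: p_def bij_betw_def)
  have pnT: "p i < k \<and> p i \<notin> T" if "i < k" "\<not> i < ?t" for i
    using that bij_betwE[OF h, rule_format, of i] by (auto simp: p_def)
  let ?B1 = "mat ?t ?t (\<lambda>(i,j). A $$ (p i, p j))"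
  let ?B2 = "mat (k - ?t) (k - ?t) (\<lambda>(i,j). A $$ (p (i + ?t), p (j + ?t)))"
  have "mat k k (\<lambda>(i,j). A $$ (p i, p j)) = diag_block_mat [?B1, ?B2]"
    using tk zero[OF pT] pnT by (intro eq_matI) (auto simp: Let_def)
  thus ?thesis
    unfolding irreducible_mat_def using A perm t0 tk
    by (auto intro!: exI[of _ p] exI[of _ "[?B1, ?B2]"])
qed

text \<open>
  The weighted graph Laplacian identity, with the edge weights \<open>- q i j\<close>: when the square on the
  right is expanded, the terms in \<open>(x i)\<^sup>2\<close> and \<open>(x j)\<^sup>2\<close> vanish because the row and column
  sums do.
\<close>

lemma zero_row_sum_form_eq:
  fixes q :: "nat \<Rightarrow> nat \<Rightarrow> real"
  assumes sym: "\<And>i j. i < k \<Longrightarrow> j < k \<Longrightarrow> q i j = q j i"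
    and row: "\<And>i. i < k \<Longrightarrow> (\<Sum>j<k. q i j) = 0"
  shows "(\<Sum>i<k. \<Sum>j<k. x i * q i j * x j) = (\<Sum>i<k. \<Sum>j<k. - q i j * (x i - x j)\<^sup>2) / 2"
proof -
  have 1: "(\<Sum>i<k. \<Sum>j<k. q i j * (x i)\<^sup>2) = 0"
    using row by (simp add: sum_distrib_right[symmetric])
  have "(\<Sum>i<k. \<Sum>j<k. q i j * (x j)\<^sup>2) = (\<Sum>j<k. \<Sum>i<k. q i j * (x j)\<^sup>2)"
    by (rule sum.swap)
  also have "\<dots> = (\<Sum>j<k. \<Sum>i<k. q j i * (x j)\<^sup>2)"
    using sym by (intro sum.cong refl) auto
  finally have 2: "(\<Sum>i<k. \<Sum>j<k. q i j * (x j)\<^sup>2) = 0" using 1 by simp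
  have "(\<Sum>i<k. \<Sum>j<k. - q i j * (x i - x j)\<^sup>2) =
    (\<Sum>i<k. \<Sum>j<k. 2 * (x i * q i j * x j) - q i j * (x i)\<^sup>2 - q i j * (x j)\<^sup>2)"
    by (intro sum.cong refl) (simp add: power2_eq_square algebra_simps)
  also have "\<dots> = 2 * (\<Sum>i<k. \<Sum>j<k. x i * q i j * x j)"
    using 1 2 by (simp add: sum_subtractf sum_distrib_left)
  finally show ?thesis by simp
qed

text \<open>
  All terms of the Laplacian identity are non-negative. If their sum vanished, then \<open>q i j\<close>
  would be zero whenever \<open>x i \<noteq> x j\<close>, and the level set of \<open>x\<close> through \<open>a\<close>, which misses
  \<open>b\<close>, would split the matrix into two blocks.
\<close>

lemma irreducible_zero_row_sum_form_pos:
  fixes q :: "nat \<Rightarrow> nat \<Rightarrow> real"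
  assumes sym: "\<And>i j. i < k \<Longrightarrow> j < k \<Longrightarrow> q i j = q j i"
    and row: "\<And>i. i < k \<Longrightarrow> (\<Sum>j<k. q i j) = 0"
    and off: "\<And>i j. i < k \<Longrightarrow> j < k \<Longrightarrow> i \<noteq> j \<Longrightarrow> q i j \<le> 0"
    and irr: "irreducible_mat (mat k k (\<lambda>(i,j). q i j))"
    and ab: "a < k" "b < k" "x a \<noteq> x b"
  shows "(\<Sum>i<k. \<Sum>j<k. x i * q i j * x j) > 0"
proof (rule ccontr)
  assume "\<not> ?thesis"
  hence le: "(\<Sum>i<k. \<Sum>j<k. - q i j * (x i - x j)\<^sup>2) \<le> 0"
    using zero_row_sum_form_eq[of k q x, OF sym row] by simp
  have nonneg: "- q i j * (x i - x j)\<^sup>2 \<ge> 0" if "i < k" "j < k" for i j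
    using off[OF that] by (cases "i = j") (auto intro: mult_nonpos_nonneg)
  have zero: "q i j * (x i - x j)\<^sup>2 = 0" if ij: "i < k" "j < k" for i j
  proof -
    have "(\<Sum>i<k. \<Sum>j<k. - q i j * (x i - x j)\<^sup>2) = 0"
      using le nonneg by (intro antisym sum_nonneg) auto
    hence "(\<Sum>j<k. - q i j * (x i - x j)\<^sup>2) = 0"
      using ij nonneg by (subst (asm) sum_nonneg_eq_0_iff) (auto intro: sum_nonneg)
    thus ?thesis using ij nonneg by (subst (asm) sum_nonneg_eq_0_iff) auto
  qed
  let ?T = "{i. i < k \<and> x i = x a}"
  have "\<not> irreducible_mat (mat k k (\<lambda>(i,j). q i j))"
  proof (rule block_zero_pattern_reducible[of _ k ?T])
    have "b \<in> {..<k} - ?T" using ab by simp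
    moreover have "?T \<subseteq> {..<k}" by blast
    ultimately show "?T \<subset> {..<k}" by blast
    have "a \<in> ?T" using ab by simp
    thus "?T \<noteq> {}" by blast
    fix i j assume "i \<in> ?T" "j < k" "j \<notin> ?T"
    hence ij: "i < k" "j < k" and "x i \<noteq> x j" by auto
    hence "q i j = 0" "q j i = 0" using zero[OF ij] sym[OF ij] by simp_all
    thus "mat k k (\<lambda>(i,j). q i j) $$ (i,j) = 0 \<and> mat k k (\<lambda>(i,j). q i j) $$ (j,i) = 0"
      using ij by simp
  qed simp
  thus False using irr by simp
qed

section \<open>The modularity matrix\<close>

lemma modularity_mat_carrier: "modularity_mat G \<in> carrier_mat (nverts G) (nverts G)"
  unfolding modularity_mat_def by (intro minus_carrier_mat smult_carrier_mat mat_carrier)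

lemma modularity_mat_index:
  assumes "a < nverts G" "b < nverts G"
  shows "modularity_mat G $$ (a,b) =
    adj_mat G $$ (a,b) - deg_vec G $ a * deg_vec G $ b / vol G (verts G)"
  using assms by (simp add: modularity_mat_def adj_mat_def)

lemma modularity_mat_symmetric: "(modularity_mat G)\<^sup>T = modularity_mat G"
proof (rule eq_matI)
  fix a b assume "a < dim_row (modularity_mat G)" "b < dim_col (modularity_mat G)"
  hence ab: "a < nverts G" "b < nverts G" using modularity_mat_carrier[of G] by auto
  thus "(modularity_mat G)\<^sup>T $$ (a,b) = modularity_mat G $$ (a,b)"
    using modularity_mat_carrier[of G]
    by (simp add: modularity_mat_index) (simp add: adj_mat_def insert_commute mult.commute)
qed (use modularity_mat_carrier[of G] in auto)

text \<open>
  Each row of the adjacency matrix sums to the degree of its vertex, which is exactly what the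
  rank-one term subtracts.
\<close>

lemma modularity_mat_row_sum:
  assumes G: "weighted_graph G" and a: "a < nverts G"
  shows "(\<Sum>b<nverts G. modularity_mat G $$ (a,b)) = 0"
proof -
  let ?n = "nverts G" and ?v = "vol G (verts G)"
  have deg: "deg_vec G $ b = (\<Sum>c<?n. adj_mat G $$ (b,c))" if "b < ?n" for b
    using that by (simp add: deg_vec_def)
  have deg_nonneg: "deg_vec G $ b \<ge> 0" if "b < ?n" for b
    unfolding deg[OF that] using that G
    by (intro sum_nonneg) (auto simp: adj_mat_def weighted_graph_def less_imp_le)
  have vol: "?v = (\<Sum>b<?n. deg_vec G $ b)" by (simp add: vol_def verts_def)
  have "(\<Sum>b<?n. modularity_mat G $$ (a,b)) = deg_vec G $ a - deg_vec G $ a * ?v / ?v"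
    using a deg[OF a] vol
    by (simp add: modularity_mat_index sum_subtractf sum_divide_distrib sum_distrib_left)
  also have "\<dots> = 0"
    \<comment> \<open>Division by zero yields zero, but a graph of volume 0 has only zero degrees.\<close>
  proof (cases "?v = 0")
    case True
    hence "deg_vec G $ a = 0"
      using vol a deg_nonneg sum_nonneg_eq_0_iff[of "{..<?n}" "\<lambda>b. deg_vec G $ b"] by auto
    thus ?thesis by simp
  qed simp
  finally show ?thesis .
qed

text \<open>
  Joint modularity is the bilinear form of the modularity matrix at the indicator vectors,
  and this holds for overlapping sets as well. With \<open>S = T\<close> it covers
  the diagonal of the community matrix.
\<close>

lemma joint_modularity_eq_sum:
  assumes "S \<subseteq> verts G" "T \<subseteq> verts G"
  shows "joint_modularity G S T = (\<Sum>a<nverts G. \<Sum>b<nverts G.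
    of_bool (a \<in> S) * modularity_mat G $$ (a,b) * of_bool (b \<in> T))"
proof -
  let ?n = "nverts G"
  have vol: "vol G U = (\<Sum>a<?n. of_bool (a \<in> U) * deg_vec G $ a)" if "U \<subseteq> verts G" for U
    using that unfolding vol_def verts_def
    by (intro sum.mono_neutral_cong_left) auto
  have adj: "adj_mat G \<in> carrier_mat ?n ?n" and chi: "char_vec G U \<in> carrier_vec ?n"
    and chi_nth: "a < ?n \<Longrightarrow> char_vec G U $ a = of_bool (a \<in> U)" for U a
    by (simp_all add: adj_mat_def char_vec_def)
  have "edge_weight G S T = (\<Sum>a<?n. char_vec G S $ a * (adj_mat G *\<^sub>v char_vec G T) $ a)"
    using adj by (simp add: edge_weight_def scalar_prod_def lessThan_atLeast0)
  also have "\<dots> = (\<Sum>a<?n. \<Sum>b<?n. of_bool (a \<in> S) * adj_mat G $$ (a,b) * of_bool (b \<in> T))"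
    by (intro sum.cong refl)
      (simp add: index_mult_mat_vec_sum[OF adj chi] chi_nth sum_distrib_left mult.assoc
        del: index_mult_mat_vec)
  finally have e: "edge_weight G S T =
    (\<Sum>a<?n. \<Sum>b<?n. of_bool (a \<in> S) * adj_mat G $$ (a,b) * of_bool (b \<in> T))" .
  have vv: "vol G S * vol G T / vol G (verts G) = (\<Sum>a<?n. \<Sum>b<?n.
    of_bool (a \<in> S) * (deg_vec G $ a * deg_vec G $ b / vol G (verts G)) * of_bool (b \<in> T))"
    unfolding vol[OF assms(1)] vol[OF assms(2)] sum_product sum_divide_distrib
    by (intro sum.cong refl) simp
  show ?thesis
    unfolding joint_modularity_def e vv sum_subtractf[symmetric]
    by (intro sum.cong refl) (simp add: modularity_mat_index left_diff_distrib right_diff_distrib)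
qed

lemma modularity_eq_joint_modularity: "modularity G S = joint_modularity G S S"
  by (simp add: modularity_def joint_modularity_def power2_eq_square)

lemma quadratic_form_of_sum:
  fixes m :: "'v \<Rightarrow> 'v \<Rightarrow> 'a :: comm_semiring_0"
  shows "(\<Sum>a\<in>V. \<Sum>b\<in>V. (\<Sum>i\<in>I. u i a) * m a b * (\<Sum>j\<in>I. u j b)) =
    (\<Sum>i\<in>I. \<Sum>j\<in>I. \<Sum>a\<in>V. \<Sum>b\<in>V. u i a * m a b * u j b)"
proof -
  have "(\<Sum>a\<in>V. \<Sum>b\<in>V. (\<Sum>i\<in>I. u i a) * m a b * (\<Sum>j\<in>I. u j b)) =
    (\<Sum>a\<in>V. \<Sum>b\<in>V. \<Sum>i\<in>I. \<Sum>j\<in>I. u i a * m a b * u j b)"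
    by (simp add: sum_distrib_left sum_distrib_right)
       (intro sum.cong refl sum.swap)
  also have "\<dots> = (\<Sum>a\<in>V. \<Sum>i\<in>I. \<Sum>j\<in>I. \<Sum>b\<in>V. u i a * m a b * u j b)"
    by (subst sum.swap[of _ I V]) (intro sum.cong refl sum.swap)
  also have "\<dots> = (\<Sum>i\<in>I. \<Sum>j\<in>I. \<Sum>a\<in>V. \<Sum>b\<in>V. u i a * m a b * u j b)"
    by (subst sum.swap[of _ I V]) (intro sum.cong refl sum.swap)
  finally show ?thesis .
qed

section \<open>Communities and positive eigenvalues\<close>

theorem theorem6p2:
  fixes G :: wgraph and k :: nat and S :: "nat \<Rightarrow> nat set"
  assumes "weighted_graph G"
    and "connected_graph G"
    and "k \<ge> 2"
    and "disjoint_family_on S {..<k}"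
    and "(\<Union>i<k. S i) = verts G"
    and "\<forall>i<k. modularity G (S i) > 0"
    and "\<forall>i<k. \<forall>j<k. i \<noteq> j \<longrightarrow> joint_modularity G (S i) (S j) \<le> 0"
    and "irreducible_mat (community_mat G k S)"
  shows "num_pos_eigenvalues (modularity_mat G) \<ge> k - 1"
proof -
  let ?n = "nverts G"
  define M where "M = modularity_mat G"
  define q where "q i j = joint_modularity G (S i) (S j)" for i j
  have M: "M \<in> carrier_mat ?n ?n" and Msym: "M\<^sup>T = M"
    by (simp_all add: M_def modularity_mat_carrier modularity_mat_symmetric)
  have Mab: "M $$ (a,b) = M $$ (b,a)" if "a < ?n" "b < ?n" for a b
    using arg_cong[OF Msym, of "\<lambda>X. X $$ (a,b)"] M that by simp
  have SV: "S i \<subseteq> verts G" if "i < k" for i using assms(5) that by auto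
  have q_sum: "q i j = (\<Sum>a<?n. \<Sum>b<?n. of_bool (a \<in> S i) * M $$ (a,b) * of_bool (b \<in> S j))"
    if "i < k" "j < k" for i j
    unfolding q_def M_def using joint_modularity_eq_sum[OF SV[OF that(1)] SV[OF that(2)]] .
  have C: "community_mat G k S = mat k k (\<lambda>(i,j). q i j)"
    unfolding community_mat_def q_def by (intro cong_mat) (auto simp: modularity_eq_joint_modularity)
  have q_sym: "q i j = q j i" if "i < k" "j < k" for i j
    unfolding q_sum[OF that] q_sum[OF that(2,1)]
    by (subst sum.swap) (intro sum.cong refl, use Mab in \<open>simp add: mult_ac\<close>)
  have cover: "(\<Sum>j<k. of_bool (b \<in> S j)) = (1::real)" if b: "b < ?n" for b
  proof -
    from b assms(5) obtain i where i: "i < k" "b \<in> S i" by (auto simp: verts_def)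
    have "(\<Sum>j<k. of_bool (b \<in> S j)) = (\<Sum>j<k. if j = i then 1 else (0::real))"
      using i assms(4) by (intro sum.cong refl) (auto simp: disjoint_family_on_def)
    thus ?thesis using i by simp
  qed
  have q_row: "(\<Sum>j<k. q i j) = 0" if i: "i < k" for i
  proof -
    have "(\<Sum>j<k. q i j) =
        (\<Sum>j<k. \<Sum>a<?n. \<Sum>b<?n. of_bool (a \<in> S i) * M $$ (a,b) * of_bool (b \<in> S j))"
      using q_sum i by simp
    also have "\<dots> = (\<Sum>a<?n. \<Sum>j<k. \<Sum>b<?n. of_bool (a \<in> S i) * M $$ (a,b) * of_bool (b \<in> S j))"
      by (rule sum.swap)
    also have "\<dots> = (\<Sum>a<?n. \<Sum>b<?n. \<Sum>j<k. of_bool (a \<in> S i) * M $$ (a,b) * of_bool (b \<in> S j))"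
      by (intro sum.cong refl sum.swap)
    also have "\<dots> = (\<Sum>a<?n. \<Sum>b<?n. of_bool (a \<in> S i) * M $$ (a,b))"
      by (intro sum.cong refl) (simp only: sum_distrib_left[symmetric] cover lessThan_iff mult_1_right)
    also have "\<dots> = 0"
      unfolding sum_distrib_left[symmetric] M_def
      by (simp add: modularity_mat_row_sum[OF assms(1)])
    finally show ?thesis .
  qed
  \<comment> \<open>Leaving out \<open>S 0\<close> rules out constant coefficients, where the form is zero.\<close>
  define X where "X = mat ?n (k - 1) (\<lambda>(a,i). of_bool (a \<in> S (Suc i)) :: real)"
  have X: "X \<in> carrier_mat ?n (k - 1)" by (simp add: X_def)
  have "num_pos_eigenvalues M \<ge> k - 1"
  proof (rule num_pos_eigenvalues_ge_positive_subspace[OF M Msym X])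
    fix y :: "real vec" assume y: "y \<in> carrier_vec (k - 1)" "y \<noteq> 0\<^sub>v (k - 1)"
    \<comment> \<open>The coefficients of \<open>X y\<close> over all communities, with 0 for \<open>S 0\<close>; they are not constant.\<close>
    define x where "x i = (case i of 0 \<Rightarrow> 0 | Suc i' \<Rightarrow> y $ i')" for i
    from y obtain i where i: "i < k - 1" "y $ i \<noteq> 0" by (auto simp: vec_eq_iff)
    have Xy: "(X *\<^sub>v y) $ a = (\<Sum>i<k. x i * of_bool (a \<in> S i))" if a: "a < ?n" for a
    proof -
      have "(X *\<^sub>v y) $ a = (\<Sum>i<k-1. y $ i * of_bool (a \<in> S (Suc i)))"
        unfolding index_mult_mat_vec_sum[OF X y(1) a] using a by (simp add: X_def mult.commute)
      also have "\<dots> = (\<Sum>i<Suc (k-1). x i * of_bool (a \<in> S i))"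
        unfolding sum.lessThan_Suc_shift by (simp add: x_def)
      finally show ?thesis using assms(3) by simp
    qed
    have w: "X *\<^sub>v y \<in> carrier_vec ?n" by (rule mult_mat_vec_carrier[OF X y(1)])
    have "(X *\<^sub>v y) \<bullet> (M *\<^sub>v (X *\<^sub>v y)) =
        (\<Sum>a<?n. \<Sum>b<?n. (X *\<^sub>v y) $ a * M $$ (a,b) * (X *\<^sub>v y) $ b)"
      using M unfolding scalar_prod_def
      by (intro sum.cong)
        (simp_all add: index_mult_mat_vec_sum[OF M w] lessThan_atLeast0 sum_distrib_left mult.assoc
          del: index_mult_mat_vec)
    also have "\<dots> = (\<Sum>a<?n. \<Sum>b<?n. (\<Sum>i<k. x i * of_bool (a \<in> S i)) * M $$ (a,b) *
        (\<Sum>j<k. x j * of_bool (b \<in> S j)))"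
      using Xy by simp
    also have "\<dots> = (\<Sum>i<k. \<Sum>j<k. \<Sum>a<?n. \<Sum>b<?n.
        (x i * of_bool (a \<in> S i)) * M $$ (a,b) * (x j * of_bool (b \<in> S j)))"
      by (rule quadratic_form_of_sum)
    also have "\<dots> = (\<Sum>i<k. \<Sum>j<k. x i * q i j * x j)"
      using q_sum by (intro sum.cong refl) (simp add: sum_distrib_left sum_distrib_right mult_ac)
    also have "\<dots> > 0"
      using q_sym q_row assms(3,7,8) i
      by (intro irreducible_zero_row_sum_form_pos[of k q 0 "Suc i"]) (auto simp: C x_def q_def)
    finally show "(X *\<^sub>v y) \<bullet> (M *\<^sub>v (X *\<^sub>v y)) > 0" .
  qed
  thus ?thesis by (simp add: M_def)
qed

end
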